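(* For all integers $0\le k\le n$, the statistic $\mathrm{des}$ over $A_{n,k}(213)$, the statistic $\mathrm{vnw}$ over $S^k_{n+1}(321)$ and the statistic $\mathrm{vpk}$ over $\Gamma_{n,k}$ are equally distributed; that is, $$\sum_{\pi\in A_{n,k}(213)}p^{\mathrm{des}(\pi)}=\sum_{\sigma\in S^k_{n+1}(321)}p^{\mathrm{vnw}(\sigma)}=\sum_{a\in\Gamma_{n,k}}p^{\mathrm{vpk}(a)}.$$
   Context: $S_n$ is the set of permutations $\pi=\pi_1\cdots\pi_n$ of $\{1,\ldots,n\}$ (for $n=0$, the single empty permutation, with no descents). A permutation avoids a pattern $p$ if it has no subsequence order-isomorphic to $p$. $\mathrm{maxdrop}(\pi)=\max\{i-\pi_i : 1\le i\le n\}$, $A(n,k)=\{\pi\in S_n:\mathrm{maxdrop}(\pi)\le k\}$ (vacuous condition for $n=0$), and $A_{n,k}(213)$ is the set of $213$-avoiding permutations in $A(n,k)$. $\mathrm{des}(\pi)$ is the number of $i$ with $1\le i\le n-1$ and $\pi_i>\pi_{i+1}$. $S^k_{n+1}(321)$ is the set of $321$-avoiding permutations $\sigma=\sigma_1\cdots\sigma_{n+1}$ of $\{1,\ldots,n+1\}$ with last element $\sigma_{n+1}=k+1$. A non-weak excedance of $\sigma$ is an $i$ with $\sigma_i<i$; $\mathrm{vnw}(\sigma)$ is the number of non-weak excedances before the last element, i.e. the number of $i$ with $1\le i\le n$ and $\sigma_i<i$. $\Gamma_{n,k}$ is the set of sequences $a=a_1a_2\cdots a_{n+k}$ consisting of $n$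 entries equal to $1$ and $k$ entries equal to $-1$ such that $a_1+\cdots+a_i\ge 0$ for all $1\le i\le n+k$. $\mathrm{vpk}(a)$ is the number of indices $i$ with $1\le i\le n+k-1$ such that $a_i=1$, $a_{i+1}=-1$, and $a_i$ is not the rightmost $1$ of $a$. *)

theory Defs
  imports "HOL-Combinatorics.Multiset_Permutations" "HOL-Library.Sublist"
begin

text \<open>
  Permutations of \<open>{1..n}\<close> are given in one-line notation, i.e. as elements of
  \<^term>\<open>permutations_of_set {1..n::nat}\<close>. Positions in words are counted from 1, as in
  \<open>w = w\<^sub>1 \<dots> w\<^sub>n\<close>, whereas the list index operator counts from 0.
\<close>

abbreviation entry :: "'a list \<Rightarrow> nat \<Rightarrow> 'a"
  where "entry w i \<equiv> w ! (i - 1)"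

definition order_isomorphic :: "nat list \<Rightarrow> nat list \<Rightarrow> bool" where
  "order_isomorphic u v \<longleftrightarrow> length u = length v \<and>
     (\<forall>i\<in>{1..length u}. \<forall>j\<in>{1..length u}. entry u i < entry u j \<longleftrightarrow> entry v i < entry v j)"

definition avoids :: "nat list \<Rightarrow> nat list \<Rightarrow> bool" where
  "avoids w pat \<longleftrightarrow> \<not> (\<exists>u. subseq u w \<and> order_isomorphic u pat)"

text \<open>
  Integer-valued, since the differences may be negative. The value for the empty word is
  unspecified, which is why \<open>A_set\<close> below treats it separately.
\<close>

definition maxdrop :: "nat list \<Rightarrow> int" where
  "maxdrop w = Max ((\<lambda>i. int i - int (entry w i)) ` {1..length w})"

definition A_set :: "nat \<Rightarrow> nat \<Rightarrow> nat list set" where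
  "A_set n k = {w \<in> permutations_of_set {1..n}. n = 0 \<or> maxdrop w \<le> int k}"

definition A_avoid :: "nat \<Rightarrow> nat \<Rightarrow> nat list \<Rightarrow> nat list set" where
  "A_avoid n k pat = {w \<in> A_set n k. avoids w pat}"

definition des :: "nat list \<Rightarrow> nat" where
  "des w = card {i. 1 \<le> i \<and> i < length w \<and> entry w i > entry w (i + 1)}"

text \<open>\<open>S_last m l pat\<close> consists of the \<open>pat\<close>-avoiding permutations of \<open>{1..m}\<close> with last entry
  \<open>l\<close>; so $S^k_{n+1}(321)$ is \<open>S_last (n + 1) (k + 1) [3,2,1]\<close>.\<close>

definition S_last :: "nat \<Rightarrow> nat \<Rightarrow> nat list \<Rightarrow> nat list set" where
  "S_last m l pat = {w \<in> permutations_of_set {1..m}. avoids w pat \<and> entry w m = l}"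

definition vnw :: "nat list \<Rightarrow> nat" where
  "vnw w = card {i. 1 \<le> i \<and> i < length w \<and> entry w i < i}"

definition Gamma_seqs :: "nat \<Rightarrow> nat \<Rightarrow> int list set" where
  "Gamma_seqs n k =
     {a. length a = n + k \<and> count_list a 1 = n \<and> count_list a (- 1) = k \<and>
         (\<forall>i\<in>{1..n + k}. (\<Sum>j = 1..i. entry a j) \<ge> 0)}"

text \<open>The last condition says that the \<open>1\<close> in position \<open>i\<close> is not the rightmost \<open>1\<close>.\<close>

definition vpk :: "int list \<Rightarrow> nat" where
  "vpk a = card {i. 1 \<le> i \<and> i < length a \<and> entry a i = 1 \<and> entry a (i + 1) = - 1 \<and>
     (\<exists>j. i < j \<and> j \<le> length a \<and> entry a j = 1)}"

end

theory Submission
  imports Defs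
begin

text \<open>
  All three sums satisfy \<open>F(0, k) = 1\<close> and
  \<open>F(n + 1, k) = F(n, k) + p * (\<Sum>l<k. F(n, l))\<close> for \<open>k \<le> n\<close>, with \<open>F(n + 1, n + 1) = F(n + 1, n)\<close>.

  For ballot sequences, the last entry is removed; if \<open>P(n, k)\<close> counts all peaks, then
  \<open>F(n + 1, k) = (\<Sum>i\<le>k. P(n, i))\<close> and \<open>P(n + 1, k + 1) = P(n, k + 1) + p * F(n + 1, k)\<close>, because
  appending \<open>- 1\<close> makes the last block of \<open>1\<close>s contribute a peak.

  Deleting the last entry \<open>k + 1\<close> of a 321-avoiding permutation and standardizing leaves a
  321-avoiding permutation whose values above \<open>k\<close> increase. Those values are weak excedances
  before and after standardization, so the non-weak excedances are unchanged. Distinguishing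
  whether the last entry of such a permutation is its maximum yields the recursion.

  A 213-avoiding word with minimum \<open>c\<close> has the form \<open>u c v\<close> with \<open>u > v\<close> entrywise. The drop
  condition is automatic on \<open>u\<close>, says \<open>|u| \<le> k\<close> at \<open>c\<close>, and becomes the condition with
  \<open>k - |u|\<close> on \<open>v\<close>. This gives the first-return form of the recursion,
  \<open>F(n + 1, k) = F(n, k) + p * (\<Sum>j<k. F(j + 1, j + 1) * F(n - j - 1, k - j - 1))\<close>.
\<close>

section \<open>Ballot polynomials\<close>

text \<open>A refinement by \<open>p\<close> of the ballot numbers. The cap \<open>min k n\<close>
  keeps row \<open>n + 1\<close> constant from \<open>k = n\<close> on, matching both families of
  permutations, whose condition involving \<open>k\<close> always holds from there on.\<close>

primrec ballot_poly :: "'a::comm_semiring_1 \<Rightarrow> nat \<Rightarrow> nat \<Rightarrow> 'a" where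
  "ballot_poly p 0 = (\<lambda>k. 1)"
| "ballot_poly p (Suc n) =
     (\<lambda>k. ballot_poly p n (min k n) + p * (\<Sum>l<min k n. ballot_poly p n l))"

lemma ballot_poly_Suc:
  "k \<le> n \<Longrightarrow> ballot_poly p (Suc n) k = ballot_poly p n k + p * (\<Sum>l<k. ballot_poly p n l)"
  by simp

lemma ballot_poly_Suc_ge: "n \<le> k \<Longrightarrow> ballot_poly p (Suc n) k = ballot_poly p (Suc n) n"
  by simp

declare ballot_poly.simps(2) [simp del]

text \<open>Both sides run over the pairs \<open>(j, i)\<close> with \<open>j + i + 1 < k\<close>;
  on the left they are grouped by \<open>l = j + i + 1\<close>.\<close>

lemma sum_triangle_swap:
  fixes f :: "nat \<Rightarrow> nat \<Rightarrow> 'a::comm_monoid_add"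
  shows "(\<Sum>l<k. \<Sum>j<l. f j (l - Suc j)) = (\<Sum>j<k. \<Sum>i<k - Suc j. f j i)"
proof (induction k)
  case (Suc k)
  have "(\<Sum>j<k. \<Sum>i<Suc k - Suc j. f j i) = (\<Sum>j<k. (\<Sum>i<k - Suc j. f j i) + f j (k - Suc j))"
    by (intro sum.cong) (auto simp: Suc_diff_Suc simp flip: sum.lessThan_Suc)
  then show ?case
    using Suc by (simp add: sum.distrib)
qed simp

text \<open>This links the linear recursion to its first-return form. Unfolding each summand once
  and applying the induction hypothesis to both resulting sums leaves, for each \<open>j\<close>,
  the recursion of the second factor.\<close>

lemma ballot_poly_sum_convolution:
  fixes p :: "'a::comm_semiring_1"
  assumes "k \<le> m"
  shows "(\<Sum>l<k. ballot_poly p m l) =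
    (\<Sum>j<k. ballot_poly p (Suc j) (Suc j) * ballot_poly p (m - Suc j) (k - Suc j))"
  using assms
proof (induction m arbitrary: k)
  case (Suc m)
  let ?F = "ballot_poly p"
  let ?N = "\<lambda>j. ?F (Suc j) (Suc j)"
  have below: "(\<Sum>l<k. ?F (Suc m) l) = (\<Sum>j<k. ?N j * ?F (Suc m - Suc j) (k - Suc j))"
    if k: "k \<le> m" for k
  proof -
    have "(\<Sum>l<k. ?F (Suc m) l) = (\<Sum>l<k. ?F m l) + p * (\<Sum>l<k. \<Sum>i<l. ?F m i)"
      using k by (simp add: ballot_poly_Suc sum.distrib sum_distrib_left)
    also have "(\<Sum>l<k. \<Sum>i<l. ?F m i) = (\<Sum>l<k. \<Sum>j<l. ?N j * ?F (m - Suc j) (l - Suc j))"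
      using k by (intro sum.cong refl Suc.IH) auto
    also have "\<dots> = (\<Sum>j<k. \<Sum>i<k - Suc j. ?N j * ?F (m - Suc j) i)"
      by (rule sum_triangle_swap)
    also have "(\<Sum>l<k. ?F m l) = (\<Sum>j<k. ?N j * ?F (m - Suc j) (k - Suc j))"
      using k by (rule Suc.IH)
    also have "(\<Sum>j<k. ?N j * ?F (m - Suc j) (k - Suc j))
        + p * (\<Sum>j<k. \<Sum>i<k - Suc j. ?N j * ?F (m - Suc j) i)
      = (\<Sum>j<k. ?N j * (?F (m - Suc j) (k - Suc j) + p * (\<Sum>i<k - Suc j. ?F (m - Suc j) i)))"
      by (simp add: sum.distrib sum_distrib_left algebra_simps)
    also have "\<dots> = (\<Sum>j<k. ?N j * ?F (Suc m - Suc j) (k - Suc j))"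
    proof (intro sum.cong refl)
      fix j assume "j \<in> {..<k}"
      then have "Suc m - Suc j = Suc (m - Suc j)" "k - Suc j \<le> m - Suc j"
        using k by auto
      then show "?N j * (?F (m - Suc j) (k - Suc j) + p * (\<Sum>i<k - Suc j. ?F (m - Suc j) i))
          = ?N j * ?F (Suc m - Suc j) (k - Suc j)"
        by (metis ballot_poly_Suc)
    qed
    finally show ?thesis .
  qed
  show ?case
  proof (cases "k \<le> m")
    case False
    then have k: "k = Suc m"
      using Suc.prems by simp
    \<comment> \<open>For \<open>k = m + 1\<close> the result \<open>below\<close> is used at
      \<open>m\<close>. The last two values of a positive row agree, which adjusts the second
      argument; the extra term \<open>l = m\<close> is the term \<open>j = m\<close>, whose second
      factor is \<open>1\<close>.\<close>
    have "?F (Suc m - Suc j) (m - Suc j) = ?F (Suc m - Suc j) (Suc m - Suc j)" if "j < m" for j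
    proof -
      have "Suc m - Suc j = Suc (m - Suc j)"
        using that by simp
      then show ?thesis
        by (metis ballot_poly_Suc_ge le_SucI order_refl)
    qed
    then have "(\<Sum>l<m. ?F (Suc m) l) = (\<Sum>j<m. ?N j * ?F (Suc m - Suc j) (Suc m - Suc j))"
      using below[of m] by simp
    moreover have "?F (Suc m) m = ?N m"
      by (metis ballot_poly_Suc_ge le_SucI order_refl)
    ultimately show ?thesis
      by (simp add: k)
  qed (rule below)
qed simp

lemma ballot_poly_convolution:
  assumes "k \<le> n"
  shows "ballot_poly p (Suc n) k = ballot_poly p n k +
    p * (\<Sum>j<k. ballot_poly p (Suc j) (Suc j) * ballot_poly p (n - Suc j) (k - Suc j))"
  using assms by (simp only: ballot_poly_Suc ballot_poly_sum_convolution)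

section \<open>Ballot sequences and peaks\<close>

lemma card_ge_1_shift: "card {i. 1 \<le> i \<and> P i} = card {j. P (Suc j)}"
proof -
  have "{i. 1 \<le> i \<and> P i} = Suc ` {j. P (Suc j)}"
    by (auto simp: image_iff Suc_le_eq gr0_conv_Suc)
  then show ?thesis
    by (simp add: card_image)
qed

text \<open>Every peak counts here, whereas \<open>vpk\<close> leaves out the one at the rightmost
  \<open>1\<close>. Appending an entry converts one statistic into the other, so the recursion needs
  both.\<close>

definition peaks :: "int list \<Rightarrow> nat" where
  "peaks a = card {j. Suc j < length a \<and> a ! j = 1 \<and> a ! Suc j = - 1}"

lemma peaks_Nil [simp]: "peaks [] = 0"
  by (simp add: peaks_def)

lemma peaks_snoc_1 [simp]: "peaks (a @ [1]) = peaks a"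
  unfolding peaks_def by (rule arg_cong[where f = card]) (auto simp: nth_append)

lemma peaks_snoc_snoc:
  "peaks (a @ [x, y]) = peaks (a @ [x]) + of_bool (x = 1 \<and> y = - 1)"
proof -
  let ?P = "\<lambda>a j. a ! j = 1 \<and> a ! Suc j = (- 1 :: int)"
  have "{j. Suc j < length (a @ [x, y]) \<and> ?P (a @ [x, y]) j}
      = {j. j < length a \<and> ?P (a @ [x]) j} \<union> (if x = 1 \<and> y = - 1 then {length a} else {})"
    by (auto simp: less_Suc_eq nth_append)
  then show ?thesis
    by (simp add: peaks_def)
qed

lemma vpk_conv_drop:
  "vpk a = card {j. Suc j < length a \<and> a ! j = 1 \<and> a ! Suc j = - 1 \<and> 1 \<in> set (drop (Suc j) a)}"
proof -
  have ex: "(\<exists>i. Suc j < i \<and> i \<le> length a \<and> entry a i = 1) \<longleftrightarrow> 1 \<in> set (drop (Suc j) a)" for j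
  proof
    assume "\<exists>i. Suc j < i \<and> i \<le> length a \<and> entry a i = 1"
    then obtain d where "Suc (Suc j + d) \<le> length a" "a ! (Suc j + d) = 1"
      by (auto simp: less_iff_Suc_add)
    then show "1 \<in> set (drop (Suc j) a)"
      unfolding in_set_conv_nth by (intro exI[of _ d]) auto
  next
    assume "1 \<in> set (drop (Suc j) a)"
    then obtain i where "i < length a - Suc j" "a ! (Suc j + i) = 1"
      by (auto simp: in_set_conv_nth)
    then show "\<exists>i. Suc j < i \<and> i \<le> length a \<and> entry a i = 1"
      by (intro exI[of _ "Suc (Suc j + i)"]) auto
  qed
  have "vpk a = card {j. Suc j < length a \<and> entry a (Suc j) = 1 \<and> entry a (Suc j + 1) = - 1 \<and>
      (\<exists>i. Suc j < i \<and> i \<le> length a \<and> entry a i = 1)}"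
    unfolding vpk_def by (rule card_ge_1_shift)
  then show ?thesis
    by (simp only: ex) simp
qed

lemma vpk_Nil [simp]: "vpk [] = 0"
  by (simp add: vpk_conv_drop)

text \<open>The new \<open>1\<close> is the rightmost one, so no peak of \<open>a\<close> is
  excluded any more.\<close>

lemma vpk_snoc_1 [simp]: "vpk (a @ [1]) = peaks a"
  unfolding vpk_conv_drop peaks_def
  by (rule arg_cong[where f = card]) (auto simp: nth_append)

text \<open>A peak created by the new entry would sit at the rightmost \<open>1\<close>, which
  \<open>vpk\<close> ignores.\<close>

lemma vpk_snoc_neg [simp]: "vpk (a @ [- 1]) = vpk a"
  unfolding vpk_conv_drop
  by (rule arg_cong[where f = card]) (auto simp: nth_append split: if_splits)

text \<open>All entries after the rightmost \<open>1\<close> are \<open>- 1\<close>, and now there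
  is at least one; so that \<open>1\<close> starts a peak, the only one that \<open>vpk a\<close>
  misses.\<close>

lemma peaks_snoc_neg:
  "set a \<subseteq> {1, - 1} \<Longrightarrow> 1 \<in> set a \<Longrightarrow> peaks (a @ [- 1]) = Suc (vpk a)"
proof (induction a rule: rev_induct)
  case (snoc x a)
  then show ?case
    by (cases "x = 1") (auto simp: peaks_snoc_snoc)
qed simp

section \<open>Ballot sequences and their last entry\<close>

lemma Gamma_seqs_eq:
  "Gamma_seqs n k = {a. length a = n + k \<and> count_list a 1 = n \<and> count_list a (- 1) = k \<and>
     (\<forall>i\<le>n + k. 0 \<le> sum_list (take i a))}"
proof -
  have entries: "(\<Sum>j = 1..i. entry a j) = sum_list (take i a)" if "i \<le> length a" for i and a :: "int list"
  proof -
    have "(\<Sum>j = 1..i. entry a j) = (\<Sum>j<i. a ! j)"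
      by (simp add: sum.atLeast1_atMost_eq)
    also have "\<dots> = sum_list (take i a)"
      using that by (simp add: sum_list_sum_nth atLeast0LessThan)
    finally show ?thesis .
  qed
  have "(\<forall>i\<in>{1..length a}. 0 \<le> (\<Sum>j = 1..i. entry a j))
      \<longleftrightarrow> (\<forall>i\<le>length a. 0 \<le> sum_list (take i a))" for a :: "int list"
  proof (intro iffI ballI allI impI)
    fix i assume *: "\<forall>i\<in>{1..length a}. 0 \<le> (\<Sum>j = 1..i. entry a j)" "i \<le> length a"
    show "0 \<le> sum_list (take i a)"
    proof (cases "i = 0")
      case False
      then have "i \<in> {1..length a}"
        using *(2) by simp
      then show ?thesis
        using * entries by metis
    qed simp
  next
    fix i assume "\<forall>i\<le>length a. 0 \<le> sum_list (take i a)" "i \<in> {1..length a}"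
    then show "0 \<le> (\<Sum>j = 1..i. entry a j)"
      using entries[of i a] by simp
  qed
  then have "(\<forall>i\<in>{1..n + k}. 0 \<le> (\<Sum>j = 1..i. entry a j))
      \<longleftrightarrow> (\<forall>i\<le>n + k. 0 \<le> sum_list (take i a))" if "length a = n + k" for a :: "int list"
    using that by metis
  then show ?thesis
    unfolding Gamma_seqs_def by (intro Collect_cong conj_cong refl) auto
qed

lemma Gamma_seqs_0_0: "Gamma_seqs 0 0 = {[]}"
  by (auto simp: Gamma_seqs_eq)

lemma count_list_pm1:
  "length (a :: int list) = count_list a 1 + count_list a (- 1) \<Longrightarrow> set a \<subseteq> {1, - 1}"
  "set a \<subseteq> {1, - 1} \<Longrightarrow> sum_list a = int (count_list a 1) - int (count_list a (- 1))"
proof -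
  have le: "count_list a 1 + count_list a (- 1) \<le> length a" for a :: "int list"
    by (induction a) auto
  show "length a = count_list a 1 + count_list a (- 1) \<Longrightarrow> set a \<subseteq> {1, - 1}"
  proof (induction a)
    case (Cons x a)
    then show ?case
      using le[of a] by (auto split: if_splits)
  qed simp
  show "set a \<subseteq> {1, - 1} \<Longrightarrow> sum_list a = int (count_list a 1) - int (count_list a (- 1))"
    by (induction a) auto
qed

lemma Gamma_seqsD:
  assumes "a \<in> Gamma_seqs n k"
  shows "set a \<subseteq> {1, - 1}" "sum_list a = int n - int k" "k \<le> n" "length a = n + k"
proof -
  have a: "length a = n + k" "count_list a 1 = n" "count_list a (- 1) = k"
    "\<forall>i\<le>n + k. 0 \<le> sum_list (take i a)"
    using assms unfolding Gamma_seqs_eq by blast+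
  show set: "set a \<subseteq> {1, - 1}"
    using a by (intro count_list_pm1) simp
  show sum: "sum_list a = int n - int k"
    using count_list_pm1(2)[OF set] a by simp
  show "k \<le> n" "length a = n + k"
    using sum a(1) a(4)[rule_format, of "n + k"] by simp_all
qed

lemma finite_Gamma_seqs [simp]: "finite (Gamma_seqs n k)"
  by (rule finite_subset[OF _ finite_lists_length_eq[of "{1, - 1}" "n + k"]])
    (auto dest: Gamma_seqsD)

lemma Gamma_seqs_empty: "n < k \<Longrightarrow> Gamma_seqs n k = {}"
  by (auto dest: Gamma_seqsD(3))

lemma nonneg_prefixes_snoc:
  "length a = m \<Longrightarrow> (\<forall>i\<le>Suc m. 0 \<le> sum_list (take i (a @ [x :: int]))) \<longleftrightarrow>
    (\<forall>i\<le>m. 0 \<le> sum_list (take i a)) \<and> 0 \<le> sum_list a + x"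
  by (auto simp: le_Suc_eq)

lemma Gamma_seqs_snoc_1: "a @ [1] \<in> Gamma_seqs (Suc n) k \<longleftrightarrow> a \<in> Gamma_seqs n k"
proof -
  have "0 \<le> sum_list a + 1" if "a \<in> Gamma_seqs n k"
    using Gamma_seqsD(2,3)[OF that] by simp
  then show ?thesis
    unfolding Gamma_seqs_eq using nonneg_prefixes_snoc[of a "n + k" 1] by auto
qed

text \<open>The total before the last step is \<open>n - k\<close>, so the full sum stays
  nonnegative exactly when \<open>k < n\<close>.\<close>

lemma Gamma_seqs_snoc_neg:
  "a @ [- 1] \<in> Gamma_seqs n (Suc k) \<longleftrightarrow> Suc k \<le> n \<and> a \<in> Gamma_seqs n k"
proof -
  have "0 \<le> sum_list a + - 1 \<longleftrightarrow> Suc k \<le> n" if "a \<in> Gamma_seqs n k"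
    using Gamma_seqsD(2)[OF that] by auto
  then show ?thesis
    unfolding Gamma_seqs_eq using nonneg_prefixes_snoc[of a "n + k" "- 1"] by auto
qed

lemma Gamma_seqs_Suc_0: "Gamma_seqs (Suc n) 0 = (\<lambda>a. a @ [1]) ` Gamma_seqs n 0"
proof (intro equalityI subsetI)
  fix a assume a: "a \<in> Gamma_seqs (Suc n) 0"
  then have "a \<noteq> []" "- 1 \<notin> set a"
    by (auto simp: Gamma_seqs_eq count_list_0_iff)
  then obtain b where "a = b @ [1]"
    using Gamma_seqsD(1)[OF a] by (cases a rule: rev_cases) auto
  with a show "a \<in> (\<lambda>a. a @ [1]) ` Gamma_seqs n 0"
    by (simp add: Gamma_seqs_snoc_1)
qed (auto simp: Gamma_seqs_snoc_1)

lemma Gamma_seqs_Suc_Suc: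
  assumes "k \<le> n"
  shows "Gamma_seqs (Suc n) (Suc k) =
    (\<lambda>a. a @ [1]) ` Gamma_seqs n (Suc k) \<union> (\<lambda>a. a @ [- 1]) ` Gamma_seqs (Suc n) k"
proof (intro equalityI subsetI)
  fix a assume a: "a \<in> Gamma_seqs (Suc n) (Suc k)"
  then have "a \<noteq> []"
    by (auto simp: Gamma_seqs_eq)
  then obtain b x where "a = b @ [x]" "x \<in> {1, - 1}"
    using Gamma_seqsD(1)[OF a] by (cases a rule: rev_cases) auto
  with a show "a \<in> (\<lambda>a. a @ [1]) ` Gamma_seqs n (Suc k) \<union> (\<lambda>a. a @ [- 1]) ` Gamma_seqs (Suc n) k"
    by (auto simp: Gamma_seqs_snoc_1 Gamma_seqs_snoc_neg)
qed (use assms in \<open>auto simp: Gamma_seqs_snoc_1 Gamma_seqs_snoc_neg\<close>)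

section \<open>Generating polynomials of ballot sequences\<close>

lemma sum_Gamma_seqs_Suc_Suc:
  fixes f :: "int list \<Rightarrow> 'a::comm_monoid_add"
  assumes "k \<le> n"
  shows "sum f (Gamma_seqs (Suc n) (Suc k)) =
    (\<Sum>a\<in>Gamma_seqs n (Suc k). f (a @ [1])) + (\<Sum>a\<in>Gamma_seqs (Suc n) k. f (a @ [- 1]))"
  unfolding Gamma_seqs_Suc_Suc[OF assms]
  by (subst sum.union_disjoint) (auto simp: sum.reindex inj_on_def)

text \<open>Removing a final \<open>- 1\<close> keeps \<open>vpk\<close> and lowers
  \<open>k\<close>; removing a final \<open>1\<close> turns \<open>vpk\<close> into
  \<open>peaks\<close>. The index \<open>i\<close> is thus the number of entries \<open>- 1\<close>
  before the last \<open>1\<close>.\<close>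

lemma sum_vpk_Gamma_seqs_Suc:
  fixes p :: "'a::comm_semiring_1"
  assumes "k \<le> Suc n"
  shows "(\<Sum>a\<in>Gamma_seqs (Suc n) k. p ^ vpk a) = (\<Sum>i\<le>k. \<Sum>a\<in>Gamma_seqs n i. p ^ peaks a)"
  using assms
proof (induction k)
  case 0
  show ?case
    by (simp add: Gamma_seqs_Suc_0 sum.reindex inj_on_def)
next
  case (Suc k)
  then show ?case
    by (simp add: sum_Gamma_seqs_Suc_Suc add.commute)
qed

text \<open>A final \<open>1\<close> adds no peak, while a final \<open>- 1\<close> makes the
  rightmost \<open>1\<close> a counted peak, whence the factor \<open>p\<close>.\<close>

lemma sum_peaks_Gamma_seqs_Suc:
  fixes p :: "'a::comm_semiring_1"
  assumes "k \<le> n"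
  shows "(\<Sum>a\<in>Gamma_seqs (Suc n) (Suc k). p ^ peaks a) =
    (\<Sum>a\<in>Gamma_seqs n (Suc k). p ^ peaks a) + p * (\<Sum>a\<in>Gamma_seqs (Suc n) k. p ^ vpk a)"
proof -
  have "peaks (a @ [- 1]) = Suc (vpk a)" if "a \<in> Gamma_seqs (Suc n) k" for a
  proof (rule peaks_snoc_neg)
    show "set a \<subseteq> {1, - 1}"
      using that by (rule Gamma_seqsD)
    show "1 \<in> set a"
      using that count_notin[of 1 a] by (cases "1 \<in> set a") (auto simp: Gamma_seqs_eq)
  qed
  then have "(\<Sum>a\<in>Gamma_seqs (Suc n) k. p ^ peaks (a @ [- 1])) =
      p * (\<Sum>a\<in>Gamma_seqs (Suc n) k. p ^ vpk a)"
    by (simp add: sum_distrib_left)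
  then show ?thesis
    by (simp add: sum_Gamma_seqs_Suc_Suc[OF assms])
qed

lemma sum_vpk_Gamma_seqs:
  fixes p :: "'a::comm_semiring_1"
  assumes "k \<le> n"
  shows "(\<Sum>a\<in>Gamma_seqs n k. p ^ vpk a) = ballot_poly p n k"
  using assms
proof (induction n arbitrary: k)
  case 0
  then show ?case
    by (simp add: Gamma_seqs_0_0)
next
  case (Suc n)
  let ?G = "\<lambda>n k. \<Sum>a\<in>Gamma_seqs n k. p ^ vpk a"
  let ?P = "\<lambda>n k. \<Sum>a\<in>Gamma_seqs n k. p ^ peaks a"
  have below: "?G (Suc n) k = ballot_poly p (Suc n) k" if k: "k \<le> n" for k
  \<comment> \<open>The peak recursion needs a row of the form \<open>Suc m\<close>, so
    \<open>n = 0\<close> is checked directly.\<close>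
  proof (cases n)
    case 0
    then show ?thesis
      using k by (simp add: sum_vpk_Gamma_seqs_Suc Gamma_seqs_0_0 ballot_poly_Suc)
  next
    case n: (Suc m)
    have P0: "?P (Suc m) 0 = ?P m 0"
      by (simp add: Gamma_seqs_Suc_0 sum.reindex inj_on_def)
    have "?G (Suc n) k = (\<Sum>i\<le>k. ?P (Suc m) i)"
      using k by (simp add: sum_vpk_Gamma_seqs_Suc n)
    also have "\<dots> = ?P m 0 + (\<Sum>i<k. ?P (Suc m) (Suc i))"
      by (simp only: P0 sum.atMost_shift)
    also have "(\<Sum>i<k. ?P (Suc m) (Suc i)) = (\<Sum>i<k. ?P m (Suc i) + p * ?G (Suc m) i)"
      using k n by (intro sum.cong refl sum_peaks_Gamma_seqs_Suc) auto
    also have "?P m 0 + \<dots> = (\<Sum>i\<le>k. ?P m i) + p * (\<Sum>i<k. ?G (Suc m) i)"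
      by (simp add: sum.atMost_shift sum.distrib sum_distrib_left add.assoc)
    also have "(\<Sum>i\<le>k. ?P m i) = ?G (Suc m) k"
      using k n by (simp add: sum_vpk_Gamma_seqs_Suc)
    also have "\<dots> = ballot_poly p n k"
      using k Suc.IH[of k] n by simp
    also have "(\<Sum>i<k. ?G (Suc m) i) = (\<Sum>i<k. ballot_poly p n i)"
      using k n Suc.IH by (intro sum.cong) auto
    finally show ?thesis
      using k by (simp add: ballot_poly_Suc)
  qed
  show ?case
  proof (cases "k \<le> n")
    case False
    then have k: "k = Suc n"
      using Suc.prems by simp
    \<comment> \<open>The additional summand \<open>i = n + 1\<close> is empty, since
      \<open>n\<close> ones cannot compensate \<open>n + 1\<close> negative entries.\<close>
    have "?G (Suc n) (Suc n) = ?G (Suc n) n"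
      by (simp add: sum_vpk_Gamma_seqs_Suc Gamma_seqs_empty)
    then show ?thesis
      using below[of n] ballot_poly_Suc_ge[of n "Suc n" p] by (simp add: k)
  qed (rule below)
qed

section \<open>Three-letter patterns\<close>

lemma order_isomorphic_321:
  "order_isomorphic u [3, 2, 1] \<longleftrightarrow> (\<exists>x y z. u = [x, y, z] \<and> z < y \<and> y < x)"
proof -
  have triple: "order_isomorphic [x, y, z] [3, 2, 1] \<longleftrightarrow> z < y \<and> y < x" for x y z
    by (auto simp: order_isomorphic_def atLeastAtMostSuc_conv)
  show ?thesis
  proof
    assume u: "order_isomorphic u [3, 2, 1]"
    then have "length u = 3"
      by (simp add: order_isomorphic_def)
    then obtain x y z where "u = [x, y, z]"
      by (auto simp: numeral_3_eq_3 length_Suc_conv)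
    then show "\<exists>x y z. u = [x, y, z] \<and> z < y \<and> y < x"
      using u triple by blast
  next
    assume "\<exists>x y z. u = [x, y, z] \<and> z < y \<and> y < x"
    then show "order_isomorphic u [3, 2, 1]"
      using triple by blast
  qed
qed

lemma order_isomorphic_213:
  "order_isomorphic u [2, 1, 3] \<longleftrightarrow> (\<exists>x y z. u = [x, y, z] \<and> y < x \<and> x < z)"
proof -
  have triple: "order_isomorphic [x, y, z] [2, 1, 3] \<longleftrightarrow> y < x \<and> x < z" for x y z
    by (auto simp: order_isomorphic_def atLeastAtMostSuc_conv)
  show ?thesis
  proof
    assume u: "order_isomorphic u [2, 1, 3]"
    then have "length u = 3"
      by (simp add: order_isomorphic_def)
    then obtain x y z where "u = [x, y, z]"
      by (auto simp: numeral_3_eq_3 length_Suc_conv)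
    then show "\<exists>x y z. u = [x, y, z] \<and> y < x \<and> x < z"
      using u triple by blast
  next
    assume "\<exists>x y z. u = [x, y, z] \<and> y < x \<and> x < z"
    then show "order_isomorphic u [2, 1, 3]"
      using triple by blast
  qed
qed

lemma avoids_321: "avoids w [3, 2, 1] \<longleftrightarrow> (\<forall>x y z. z < y \<longrightarrow> y < x \<longrightarrow> \<not> subseq [x, y, z] w)"
  unfolding avoids_def order_isomorphic_321 by blast

lemma avoids_213: "avoids w [2, 1, 3] \<longleftrightarrow> (\<forall>x y z. y < x \<longrightarrow> x < z \<longrightarrow> \<not> subseq [x, y, z] w)"
  unfolding avoids_def order_isomorphic_213 by blast

lemma subseq_set: "subseq xs w \<Longrightarrow> set xs \<subseteq> set w"
  by (auto simp: subseq_conv_nths dest: in_set_nthsD)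

lemma subseq_snoc_iff:
  "subseq (us @ [x]) (w @ [a]) \<longleftrightarrow> subseq (us @ [x]) w \<or> x = a \<and> subseq us w"
proof
  assume "subseq (us @ [x]) (w @ [a])"
  then obtain vs vs' where vs: "us @ [x] = vs @ vs'" "subseq vs w" "subseq vs' [a]"
    by (auto simp: subseq_append_iff)
  show "subseq (us @ [x]) w \<or> x = a \<and> subseq us w"
  proof (cases vs' rule: rev_cases)
    case (snoc vs'' b)
    then have "vs' = [a]"
      using list_emb_length[OF vs(3)] subseq_set[OF vs(3)] by auto
    then show ?thesis
      using vs by simp
  qed (use vs in simp)
qed (auto intro: subseq_rev_drop_many)

lemma subseq_map_iff: "subseq xs (map f w) \<longleftrightarrow> (\<exists>ys. subseq ys w \<and> xs = map f ys)"
  by (auto simp: subseq_conv_nths nths_map)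

section \<open>321-avoiding permutations by last entry\<close>

text \<open>Exactly the condition under which appending the letter \<open>k\<close> completes no 321
  pattern; forbidden pairs are used to match \<open>avoids_321\<close>.\<close>

definition increasing_above :: "nat \<Rightarrow> nat list \<Rightarrow> bool" where
  "increasing_above k w \<longleftrightarrow> (\<forall>x y. k < y \<longrightarrow> y < x \<longrightarrow> \<not> subseq [x, y] w)"

lemma avoids_321_snoc: "avoids (w @ [a]) [3, 2, 1] \<longleftrightarrow> avoids w [3, 2, 1] \<and> increasing_above a w"
proof -
  have "subseq [x, y, z] (w @ [a]) \<longleftrightarrow> subseq [x, y, z] w \<or> z = a \<and> subseq [x, y] w" for x y z
    using subseq_snoc_iff[of "[x, y]" z w a] by simp
  then show ?thesis
    unfolding avoids_321 increasing_above_def by blast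
qed

lemma increasing_above_snoc:
  "increasing_above k (w @ [a]) \<longleftrightarrow> increasing_above k w \<and> (k < a \<longrightarrow> (\<forall>x\<in>set w. x \<le> a))"
proof -
  have "subseq [x, y] (w @ [a]) \<longleftrightarrow> subseq [x, y] w \<or> y = a \<and> x \<in> set w" for x y
    using subseq_snoc_iff[of "[x]" y w a] by (simp add: subseq_singleton_left)
  then show ?thesis
    unfolding increasing_above_def by (metis not_less)
qed

lemma increasing_above_mono: "increasing_above k w \<Longrightarrow> k \<le> l \<Longrightarrow> increasing_above l w"
  by (auto simp: increasing_above_def)

lemma increasing_above_trivial: "set w \<subseteq> {..Suc k} \<Longrightarrow> increasing_above k w"
  by (auto simp: increasing_above_def dest!: subseq_set)

text \<open>The increasing map from the naturals onto those other than \<open>k + 1\<close>; applied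
  entrywise, it undoes the standardization that follows deletion of \<open>k + 1\<close>.\<close>

definition skip :: "nat \<Rightarrow> nat \<Rightarrow> nat" where
  "skip k x = (if x \<le> k then x else Suc x)"

lemma skip_less_iff [simp]: "skip k x < skip k y \<longleftrightarrow> x < y"
  by (auto simp: skip_def)

lemma skip_eq_iff [simp]: "skip k x = skip k y \<longleftrightarrow> x = y"
  by (auto simp: skip_def)

lemma inj_skip: "inj (skip k)"
  by (simp add: inj_def)

lemma Suc_less_skip_iff: "Suc k < skip k x \<longleftrightarrow> k < x"
  by (auto simp: skip_def)

lemma image_skip:
  assumes "k \<le> n"
  shows "skip k ` {1..n} = {1..Suc n} - {Suc k}"
proof (intro equalityI subsetI)
  fix x assume "x \<in> {1..Suc n} - {Suc k}"
  then have "x = skip k (if x \<le> k then x else x - 1)"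
    and "(if x \<le> k then x else x - 1) \<in> {1..n}"
    using assms by (auto simp: skip_def)
  then show "x \<in> skip k ` {1..n}"
    by blast
qed (use assms in \<open>auto simp: skip_def split: if_splits\<close>)

lemma avoids_321_map_skip: "avoids (map (skip k) w) [3, 2, 1] \<longleftrightarrow> avoids w [3, 2, 1]"
proof
  assume av: "avoids (map (skip k) w) [3, 2, 1]"
  have "subseq [skip k x, skip k y, skip k z] (map (skip k) w)" if "subseq [x, y, z] w" for x y z
    using subseq_map[OF that, of "skip k"] by simp
  then show "avoids w [3, 2, 1]"
    using av unfolding avoids_321 by (meson skip_less_iff)
next
  assume av: "avoids w [3, 2, 1]"
  show "avoids (map (skip k) w) [3, 2, 1]"
    unfolding avoids_321
  proof (intro allI impI notI)
    fix x y z assume less: "z < y" "y < x" and "subseq [x, y, z] (map (skip k) w)"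
    then obtain x' y' z' where "subseq [x', y', z'] w" "x = skip k x'" "y = skip k y'" "z = skip k z'"
      unfolding subseq_map_iff by (auto simp: Cons_eq_map_conv)
    then show False
      using av less unfolding avoids_321 by (metis skip_less_iff)
  qed
qed

lemma increasing_above_map_skip:
  "increasing_above (Suc k) (map (skip k) w) \<longleftrightarrow> increasing_above k w"
proof
  assume inc: "increasing_above (Suc k) (map (skip k) w)"
  have "subseq [skip k x, skip k y] (map (skip k) w)" if "subseq [x, y] w" for x y
    using subseq_map[OF that, of "skip k"] by simp
  then show "increasing_above k w"
    using inc unfolding increasing_above_def by (meson Suc_less_skip_iff skip_less_iff)
next
  assume inc: "increasing_above k w"
  show "increasing_above (Suc k) (map (skip k) w)"
    unfolding increasing_above_def
  proof (intro allI impI notI)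
    fix x y assume less: "Suc k < y" "y < x" and "subseq [x, y] (map (skip k) w)"
    then obtain x' y' where "subseq [x', y'] w" "x = skip k x'" "y = skip k y'"
      unfolding subseq_map_iff by (auto simp: Cons_eq_map_conv)
    then show False
      using inc less unfolding increasing_above_def by (metis Suc_less_skip_iff skip_less_iff)
  qed
qed

text \<open>For \<open>k \<le> n\<close> these are the standardized remainders of the 321-avoiders
  of length \<open>n + 1\<close> once the last entry \<open>k + 1\<close> is deleted.\<close>

definition inc_avoiders :: "nat \<Rightarrow> nat \<Rightarrow> nat list set" where
  "inc_avoiders n k = {w \<in> permutations_of_set {1..n}. avoids w [3, 2, 1] \<and> increasing_above k w}"

lemma inc_avoidersD:
  assumes "w \<in> inc_avoiders n k"
  shows "set w = {1..n}" "distinct w" "length w = n"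
    "avoids w [3, 2, 1]" "increasing_above k w"
proof -
  show *: "set w = {1..n}" "distinct w" "avoids w [3, 2, 1]" "increasing_above k w"
    using assms unfolding inc_avoiders_def permutations_of_set_def by blast+
  show "length w = n"
    using distinct_card[OF *(2)] by (simp add: *(1))
qed

lemma finite_inc_avoiders [simp]: "finite (inc_avoiders n k)"
  by (simp add: inc_avoiders_def)

lemma finite_S_last [simp]: "finite (S_last m l pat)"
  by (simp add: S_last_def)

text \<open>Appending \<open>k + 1\<close> demands that the values above it increase, and pulling
  back along \<open>skip k\<close> lowers that threshold to \<open>k\<close>.\<close>

lemma S_last_Suc:
  assumes "k \<le> n"
  shows "S_last (Suc n) (Suc k) [3, 2, 1] = (\<lambda>w. map (skip k) w @ [Suc k]) ` inc_avoiders n k"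
proof -
  have iff: "map (skip k) w @ [Suc k] \<in> S_last (Suc n) (Suc k) [3, 2, 1] \<longleftrightarrow> w \<in> inc_avoiders n k"
    if len: "length w = n" for w
  proof -
    have "Suc k \<notin> set (map (skip k) w)"
      by (auto simp: skip_def split: if_splits)
    moreover have "Suc k \<in> {1..Suc n}"
      using assms by simp
    moreover have "set (map (skip k) w @ [Suc k]) = insert (Suc k) (set (map (skip k) w))"
      by simp
    ultimately have "set (map (skip k) w @ [Suc k]) = {1..Suc n}
        \<longleftrightarrow> set (map (skip k) w) = {1..Suc n} - {Suc k}"
      by (metis Diff_insert_absorb insert_Diff)
    also have "\<dots> \<longleftrightarrow> skip k ` set w = skip k ` {1..n}"
      by (simp only: image_skip[OF assms] set_map)
    also have "\<dots> \<longleftrightarrow> set w = {1..n}"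
      by (rule inj_image_eq_iff[OF inj_skip])
    finally have set: "set (map (skip k) w @ [Suc k]) = {1..Suc n} \<longleftrightarrow> set w = {1..n}" .
    have distinct: "distinct (map (skip k) w @ [Suc k]) \<longleftrightarrow> distinct w"
      using \<open>Suc k \<notin> set (map (skip k) w)\<close>
      by (simp add: distinct_map inj_on_subset[OF inj_skip])
    have "entry (map (skip k) w @ [Suc k]) (Suc n) = Suc k"
      by (simp add: nth_append len)
    then show ?thesis
      by (simp only: S_last_def inc_avoiders_def permutations_of_set_def mem_Collect_eq set distinct
          avoids_321_snoc avoids_321_map_skip increasing_above_map_skip simp_thms conj_assoc)
  qed
  show ?thesis
  proof (intro equalityI subsetI)
    fix \<sigma> assume \<sigma>: "\<sigma> \<in> S_last (Suc n) (Suc k) [3, 2, 1]"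
    then have set: "set \<sigma> = {1..Suc n}" and dist: "distinct \<sigma>" and last: "\<sigma> ! n = Suc k"
      by (auto simp: S_last_def permutations_of_set_def)
    then have len: "length \<sigma> = Suc n"
      using distinct_card[OF dist] by simp
    then obtain u where u: "\<sigma> = u @ [Suc k]" "length u = n"
      using last by (cases \<sigma> rule: rev_cases) auto
    have "set u = {1..Suc n} - {Suc k}"
      using set dist by (auto simp: u)
    then have "set u \<subseteq> range (skip k)"
      using image_skip[OF assms] by blast
    then obtain w where "u = map (skip k) w"
      by (metis ex_map_conv subset_iff rangeE)
    then show "\<sigma> \<in> (\<lambda>w. map (skip k) w @ [Suc k]) ` inc_avoiders n k"
      using \<sigma> u iff[of w] by auto
  qed (use iff inc_avoidersD(3) in auto)
qed

text \<open>In \<open>{1..Suc n}\<close> only one value exceeds \<open>n\<close>, so from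
  \<open>k = n\<close> on there is no pair to forbid.\<close>

lemma inc_avoiders_Suc_ge: "n \<le> k \<Longrightarrow> inc_avoiders (Suc n) k = inc_avoiders (Suc n) n"
proof -
  assume "n \<le> k"
  then have "increasing_above k w" "increasing_above n w" if "set w = {1..Suc n}" for w
    using that by (auto intro!: increasing_above_trivial)
  then show ?thesis
    by (auto simp: inc_avoiders_def permutations_of_set_def)
qed

text \<open>The last entry is either the maximum, which can be removed, or comes after it; then
  being increasing above \<open>k\<close> forces it to be at most \<open>k\<close>. Conversely,
  avoiding 321 with last entry \<open>l + 1\<close> makes the values above \<open>l + 1\<close>
  increase, hence those above \<open>k\<close>.\<close>

lemma inc_avoiders_Suc:
  assumes "k \<le> n"
  shows "inc_avoiders (Suc n) k =
    (\<lambda>w. w @ [Suc n]) ` inc_avoiders n k \<union> (\<Union>l<k. S_last (Suc n) (Suc l) [3, 2, 1])"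
proof (intro equalityI subsetI)
  fix w assume w: "w \<in> inc_avoiders (Suc n) k"
  obtain u a where u: "w = u @ [a]" "length u = n"
    using inc_avoidersD(3)[OF w] by (cases w rule: rev_cases) auto
  have set: "insert a (set u) = {1..Suc n}" "a \<notin> set u" "distinct u"
    using inc_avoidersD(1,2)[OF w] by (auto simp: u)
  show "w \<in> (\<lambda>w. w @ [Suc n]) ` inc_avoiders n k \<union> (\<Union>l<k. S_last (Suc n) (Suc l) [3, 2, 1])"
  proof (cases "a = Suc n")
    case True
    have "set u = insert a (set u) - {a}"
      using set(2) by simp
    also have "\<dots> = {1..n}"
      unfolding set(1) using True by auto
    finally have "set u = {1..n}" .
    then have "u \<in> inc_avoiders n k"
      using w set by (simp add: u inc_avoiders_def permutations_of_set_def avoids_321_snoc increasing_above_snoc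
          del: One_nat_def)
    then show ?thesis
      by (simp add: u True)
  next
    case False
    then have "Suc n \<in> set u"
      using set(1) by fastforce
    moreover have "a \<in> {1..Suc n}"
      using set(1) by blast
    then have "1 \<le> a" "a \<le> n"
      using False by simp_all
    moreover have "k < a \<longrightarrow> (\<forall>x\<in>set u. x \<le> a)"
      using inc_avoidersD(5)[OF w] by (simp add: u increasing_above_snoc)
    ultimately have "a - 1 < k" "Suc (a - 1) = a"
      by (auto simp: not_less)
    moreover have "w \<in> S_last (Suc n) a [3, 2, 1]"
      using w by (simp add: S_last_def inc_avoiders_def u nth_append)
    ultimately show ?thesis
      by (metis UN_I UnI2 lessThan_iff)
  qed
next
  fix w assume "w \<in> (\<lambda>w. w @ [Suc n]) ` inc_avoiders n k \<union> (\<Union>l<k. S_last (Suc n) (Suc l) [3, 2, 1])"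
  then consider u where "w = u @ [Suc n]" "u \<in> inc_avoiders n k"
    | l where "l < k" "w \<in> S_last (Suc n) (Suc l) [3, 2, 1]"
    by blast
  then show "w \<in> inc_avoiders (Suc n) k"
  proof cases
    case 1
    then have "set u \<subseteq> {..Suc (Suc n)}"
      using inc_avoidersD(1) by fastforce
    then have "increasing_above (Suc n) u"
      by (rule increasing_above_trivial)
    then show ?thesis
      using inc_avoidersD[OF 1(2)] unfolding inc_avoiders_def permutations_of_set_def 1(1)
      by (auto simp: avoids_321_snoc increasing_above_snoc simp del: One_nat_def)
  next
    case 2
    then obtain u where u: "w = map (skip l) u @ [Suc l]" "u \<in> inc_avoiders n l"
      using assms by (auto simp: S_last_Suc simp del: One_nat_def)
    have "increasing_above k w"
      using inc_avoidersD(5)[OF u(2)] 2(1)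
      by (auto simp: u(1) increasing_above_snoc increasing_above_map_skip
          intro: increasing_above_mono[of "Suc l"])
    then show ?thesis
      using 2(2) by (simp add: S_last_def inc_avoiders_def)
  qed
qed

text \<open>With indices from 0, \<open>w ! j \<le> j\<close> says that position
  \<open>j + 1\<close> carries a value below \<open>j + 1\<close>. Unlike in \<open>vnw\<close>, the
  last position is included.\<close>

definition nonweak_excedances :: "nat list \<Rightarrow> nat" where
  "nonweak_excedances w = card {j. j < length w \<and> w ! j \<le> j}"

lemma nonweak_excedances_snoc:
  "nonweak_excedances (w @ [a]) = nonweak_excedances w + of_bool (a \<le> length w)"
proof -
  have "{j. j < length (w @ [a]) \<and> (w @ [a]) ! j \<le> j}
      = {j. j < length w \<and> w ! j \<le> j} \<union> (if a \<le> length w then {length w} else {})"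
    by (auto simp: less_Suc_eq nth_append)
  then show ?thesis
    by (simp add: nonweak_excedances_def)
qed

lemma vnw_snoc: "vnw (w @ [a]) = nonweak_excedances w"
  unfolding vnw_def nonweak_excedances_def card_ge_1_shift
  by (rule arg_cong[where f = card]) (auto simp: nth_append less_Suc_eq_le)

text \<open>The \<open>n - w ! j\<close> values larger than \<open>w ! j\<close> must all stand to
  its right, where only \<open>n - j - 1\<close> places exist.\<close>

lemma inc_avoiders_weak_excedance:
  assumes w: "w \<in> inc_avoiders n k" and j: "j < n" "k < w ! j"
  shows "j < w ! j"
proof -
  have "w ! j \<le> n"
    using inc_avoidersD(1,3)[OF w] j nth_mem[of j w] by auto
  have decomp: "w = take j w @ w ! j # drop (Suc j) w"
    using inc_avoidersD(3)[OF w] j by (simp add: id_take_nth_drop)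
  have "{w ! j<..n} \<subseteq> set (drop (Suc j) w)"
  proof
    fix x assume x: "x \<in> {w ! j<..n}"
    then have "x \<in> set w"
      using inc_avoidersD(1)[OF w] by auto
    then have "x \<in> set (take j w) \<union> {w ! j} \<union> set (drop (Suc j) w)"
      by (subst (asm) decomp) auto
    moreover have "x \<notin> set (take j w)"
    proof
      assume "x \<in> set (take j w)"
      then have "subseq ([x] @ [w ! j]) (take j w @ w ! j # drop (Suc j) w)"
        by (intro list_emb_append_mono) (simp_all add: subseq_singleton_left)
      then have "subseq [x, w ! j] w"
        by (simp flip: decomp)
      then show False
        using inc_avoidersD(5)[OF w] x j by (auto simp: increasing_above_def)
    qed
    ultimately show "x \<in> set (drop (Suc j) w)"
      using x by auto
  qed
  then have "card {w ! j<..n} \<le> card (set (drop (Suc j) w))"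
    by (intro card_mono) auto
  also have "\<dots> \<le> n - Suc j"
    using card_length[of "drop (Suc j) w"] inc_avoidersD(3)[OF w] by simp
  finally show ?thesis
    using \<open>w ! j \<le> n\<close> j by simp
qed

text \<open>Entries up to \<open>k\<close> are fixed by \<open>skip k\<close>; entries above
  \<open>k\<close> are weak excedances and remain so when raised by one.\<close>

lemma nonweak_excedances_map_skip:
  assumes "w \<in> inc_avoiders n k"
  shows "nonweak_excedances (map (skip k) w) = nonweak_excedances w"
proof -
  have "skip k (w ! j) \<le> j \<longleftrightarrow> w ! j \<le> j" if "j < length w" for j
    using inc_avoiders_weak_excedance[OF assms, of j] inc_avoidersD(3)[OF assms] that
    by (cases "w ! j \<le> k") (auto simp: skip_def)
  then show ?thesis
    unfolding nonweak_excedances_def by (intro arg_cong[where f = card]) auto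
qed

section \<open>Generating polynomials of 321-avoiders\<close>

lemma sum_S_last:
  fixes f :: "nat list \<Rightarrow> 'a::comm_monoid_add"
  assumes "k \<le> n"
  shows "sum f (S_last (Suc n) (Suc k) [3, 2, 1]) = (\<Sum>w\<in>inc_avoiders n k. f (map (skip k) w @ [Suc k]))"
  unfolding S_last_Suc[OF assms]
  by (subst sum.reindex) (auto simp: inj_on_def inj_map_eq_map[OF inj_skip])

lemma sum_nonweak_excedances_inc_avoiders:
  fixes p :: "'a::comm_semiring_1"
  shows "(\<Sum>w\<in>inc_avoiders n k. p ^ nonweak_excedances w) = ballot_poly p n k"
proof (induction n arbitrary: k)
  case 0
  have "inc_avoiders 0 k = {[]}"
    by (auto simp: inc_avoiders_def avoids_321 increasing_above_def simp del: One_nat_def)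
  then show ?case
    by (simp add: nonweak_excedances_def)
next
  case (Suc n)
  let ?N = "\<lambda>w. p ^ nonweak_excedances w"
  let ?S = "\<lambda>l. S_last (Suc n) (Suc l) [3, 2, 1]"
  have below: "(\<Sum>w\<in>inc_avoiders (Suc n) k. ?N w) = ballot_poly p (Suc n) k" if k: "k \<le> n" for k
  proof -
    have last: "w ! n = Suc l" if "w \<in> ?S l" for w l
      using that by (simp add: S_last_def)
    have "(\<Sum>w\<in>inc_avoiders (Suc n) k. ?N w) =
        (\<Sum>w\<in>(\<lambda>w. w @ [Suc n]) ` inc_avoiders n k. ?N w) + (\<Sum>w\<in>(\<Union>l<k. ?S l). ?N w)"
      unfolding inc_avoiders_Suc[OF k]
    proof (rule sum.union_disjoint)
      have "w @ [Suc n] \<notin> ?S l" if "l < k" "w \<in> inc_avoiders n k" for l w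
        using last[of "w @ [Suc n]" l] inc_avoidersD(3)[OF that(2)] that(1) k by (auto simp: nth_append)
      then show "(\<lambda>w. w @ [Suc n]) ` inc_avoiders n k \<inter> (\<Union>l<k. ?S l) = {}"
        by blast
    qed auto
    \<comment> \<open>The maximum \<open>n + 1\<close> in position \<open>n + 1\<close> is a weak
      excedance, so appending it keeps the count.\<close>
    also have "(\<Sum>w\<in>(\<lambda>w. w @ [Suc n]) ` inc_avoiders n k. ?N w) = (\<Sum>w\<in>inc_avoiders n k. ?N w)"
      by (simp add: sum.reindex inj_on_def nonweak_excedances_snoc inc_avoidersD(3))
    also have "(\<Sum>w\<in>(\<Union>l<k. ?S l). ?N w) = (\<Sum>l<k. \<Sum>w\<in>?S l. ?N w)"
    proof (rule sum.UNION_disjoint; safe?)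
      fix i j w assume "w \<in> ?S i" "w \<in> ?S j" "i \<noteq> j"
      then show "w \<in> {}"
        using last[of w i] last[of w j] by simp
    qed auto
    also have "\<dots> = (\<Sum>l<k. p * (\<Sum>w\<in>inc_avoiders n l. ?N w))"
    proof (rule sum.cong)
      fix l assume "l \<in> {..<k}"
      then have l: "l < n"
        using k by simp
      have "(\<Sum>w\<in>?S l. ?N w) = (\<Sum>w\<in>inc_avoiders n l. ?N (map (skip l) w @ [Suc l]))"
        using l by (intro sum_S_last) simp
      \<comment> \<open>The last entry \<open>l + 1 \<le> n\<close> in position \<open>n + 1\<close>
        is a new non-weak excedance, which gives the factor \<open>p\<close>.\<close>
      also have "\<dots> = (\<Sum>w\<in>inc_avoiders n l. p * ?N w)"
        using l by (simp add: nonweak_excedances_snoc nonweak_excedances_map_skip inc_avoidersD(3))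
      finally show "(\<Sum>w\<in>?S l. ?N w) = p * (\<Sum>w\<in>inc_avoiders n l. ?N w)"
        by (simp add: sum_distrib_left)
    qed simp
    finally show ?thesis
      using k by (simp add: Suc.IH ballot_poly_Suc sum_distrib_left)
  qed
  show ?case
  proof (cases "k \<le> n")
    case False
    then show ?thesis
      using below[of n] inc_avoiders_Suc_ge[of n k] ballot_poly_Suc_ge[of n k p] by simp
  qed (rule below)
qed

lemma sum_vnw_S_last:
  fixes p :: "'a::comm_semiring_1"
  assumes "k \<le> n"
  shows "(\<Sum>s\<in>S_last (n + 1) (k + 1) [3, 2, 1]. p ^ vnw s) = ballot_poly p n k"
  using assms
  by (simp add: sum_S_last vnw_snoc nonweak_excedances_map_skip sum_nonweak_excedances_inc_avoiders
      del: One_nat_def flip: Suc_eq_plus1)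

section \<open>213-avoiding words by minimum\<close>

lemma des_conv_nth: "des w = card {j. Suc j < length w \<and> w ! Suc j < w ! j}"
  unfolding des_def card_ge_1_shift by simp

lemma des_Nil [simp]: "des [] = 0"
  by (simp add: des_conv_nth)

lemma des_Cons: "des (x # w) = of_bool (w \<noteq> [] \<and> hd w < x) + des w"
proof -
  have "{j. Suc j < length (x # w) \<and> (x # w) ! Suc j < (x # w) ! j}
      = (if w \<noteq> [] \<and> hd w < x then {0} else {}) \<union> Suc ` {j. Suc j < length w \<and> w ! Suc j < w ! j}"
    (is "?L = ?R")
  proof (rule set_eqI)
    show "j \<in> ?L \<longleftrightarrow> j \<in> ?R" for j
      by (cases j) (auto simp: hd_conv_nth)
  qed
  moreover have "finite {j. Suc j < length w \<and> w ! Suc j < w ! j}"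
    by (rule finite_subset[of _ "{..<length w}"]) auto
  ultimately show ?thesis
    unfolding des_conv_nth by (simp only:) (simp add: card_image card_insert_if)
qed

text \<open>The step down into the minimum \<open>c\<close> is a descent whenever \<open>u\<close>
  is nonempty, and the step out of \<open>c\<close> never is.\<close>

lemma des_append_min:
  assumes "\<forall>x\<in>set u \<union> set v. c < x"
  shows "des (u @ c # v) = des u + of_bool (u \<noteq> []) + des v"
  using assms
proof (induction u)
  case Nil
  then show ?case
    by (cases v) (auto simp: des_Cons)
next
  case (Cons x u)
  then show ?case
    by (cases u) (auto simp: des_Cons)
qed

text \<open>Nothing of \<open>A\<close> lies below the maximum of \<open>B\<close>, so
  \<open>B\<close> fills the interval from its bottom up to that maximum; its cardinality then fixes
  the cut.\<close>

lemma interval_split: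
  fixes A B :: "nat set"
  assumes AB: "A \<union> B = {a<..a + n}" and less: "\<And>x y. x \<in> A \<Longrightarrow> y \<in> B \<Longrightarrow> y < x"
  shows "B = {a<..a + card B}" "A = {a + card B<..a + n}"
proof -
  have in_range: "x \<in> A \<or> x \<in> B \<longleftrightarrow> a < x \<and> x \<le> a + n" for x
    using AB by (metis Un_iff greaterThanAtMost_iff)
  obtain M where M: "a \<le> M" "M \<le> a + n" "B = {a<..M}"
  proof (cases "B = {}")
    case True
    show ?thesis
      by (rule that[of a]) (simp_all add: True)
  next
    case False
    have "finite (A \<union> B)"
      unfolding AB by simp
    then have fin: "finite B"
      by simp
    have Max: "Max B \<in> B"
      using fin False by (rule Max_in)
    have "y \<in> B \<longleftrightarrow> a < y \<and> y \<le> Max B" for y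
      using Max_ge[OF fin, of y] in_range[of y] in_range[of "Max B"] less[OF _ Max, of y] Max
      by linarith
    then have "B = {a<..Max B}"
      by (intro set_eqI) simp
    moreover have "a \<le> Max B" "Max B \<le> a + n"
      using in_range[of "Max B"] Max by auto
    ultimately show ?thesis
      using that by blast
  qed
  have card: "card B = M - a"
    by (simp add: M(3))
  show "B = {a<..a + card B}"
    unfolding card using M(1,3) by simp
  have "x \<in> A \<longleftrightarrow> M < x \<and> x \<le> a + n" for x
  proof -
    have "x \<in> B \<longleftrightarrow> a < x \<and> x \<le> M"
      by (simp add: M(3))
    moreover have "x \<notin> A \<or> x \<notin> B"
      using less[of x x] by blast
    ultimately show ?thesis
      using in_range[of x] M(1,2) by linarith
  qed
  then have "A = {M<..a + n}"
    by (intro set_eqI) simp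
  then show "A = {a + card B<..a + n}"
    unfolding card using M(1) by simp
qed

text \<open>A letter of \<open>u\<close>, then \<open>c\<close>, then a larger letter of
  \<open>v\<close> would form 213, which gives the comparison. Conversely, an occurrence starting in
  \<open>u\<close> and ending in \<open>c # v\<close> contradicts it, and the minimum
  \<open>c\<close> cannot play the 2.\<close>

lemma avoids_213_append_min:
  assumes c: "\<forall>x\<in>set u \<union> set v. c < x"
  shows "avoids (u @ c # v) [2, 1, 3] \<longleftrightarrow>
    avoids u [2, 1, 3] \<and> avoids v [2, 1, 3] \<and> (\<forall>x\<in>set u. \<forall>y\<in>set v. y \<le> x)"
proof (intro iffI conjI ballI)
  assume av: "avoids (u @ c # v) [2, 1, 3]"
  then show "avoids u [2, 1, 3]" "avoids v [2, 1, 3]"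
    unfolding avoids_213 by (meson list_emb_append2 list_emb_Cons subseq_rev_drop_many)+
  fix x y assume xy: "x \<in> set u" "y \<in> set v"
  then have "subseq ([x] @ [c, y]) (u @ c # v)"
    by (intro list_emb_append_mono) (simp_all add: subseq_singleton_left)
  then show "y \<le> x"
    using av c xy unfolding avoids_213 by (metis Un_iff append.simps not_less)
next
  assume av: "avoids u [2, 1, 3] \<and> avoids v [2, 1, 3] \<and> (\<forall>x\<in>set u. \<forall>y\<in>set v. y \<le> x)"
  have le: "y \<le> x" if "x \<in> set u" "y \<in> set (c # v)" for x y
    using that av c by (auto intro: less_imp_le)
  show "avoids (u @ c # v) [2, 1, 3]"
    unfolding avoids_213
  proof (intro allI impI notI)
    fix x y z assume less: "y < x" "x < z" and "subseq [x, y, z] (u @ c # v)"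
    then obtain us vs where s: "[x, y, z] = us @ vs" "subseq us u" "subseq vs (c # v)"
      by (auto simp: subseq_append_iff)
    have mem: "set us \<subseteq> set u" "set vs \<subseteq> set (c # v)"
      using s(2,3) by (blast dest: subseq_set)+
    \<comment> \<open>Here \<open>us\<close> and \<open>vs\<close> are the parts of the occurrence
      in \<open>u\<close> and in \<open>c # v\<close>; if neither is empty, it begins in
      \<open>u\<close> and ends in \<open>c # v\<close>.\<close>
    consider "us = []" "vs = [x, y, z]" | "us = [x, y, z]" | "x \<in> set us" "z \<in> set vs"
      using s(1) by (auto simp: Cons_eq_append_conv)
    then show False
    proof cases
      case 1
      have "x \<noteq> c"
      proof
        assume "x = c"
        then have "y \<in> set v"
          using s(3) subseq_set[of "[y, z]" v] by (simp add: 1)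
        then have "c < y"
          using c by blast
        then show False
          using less(1) \<open>x = c\<close> by simp
      qed
      then have "subseq [x, y, z] v"
        using s(3) by (simp add: 1)
      then show False
        using av less by (auto simp: avoids_213 simp del: One_nat_def)
    next
      case 2
      then show False
        using s(2) av less by (auto simp: avoids_213 simp del: One_nat_def)
    next
      case 3
      then show False
        using le[of x z] mem less by auto
    qed
  qed
qed

text \<open>The value offset \<open>s\<close> lets the recursion act on factors of a word without standardizing them.\<close>

definition drop_avoiders :: "nat \<Rightarrow> nat \<Rightarrow> nat \<Rightarrow> nat list set" where
  "drop_avoiders s n k = {w \<in> permutations_of_set {s<..s + n}. avoids w [2, 1, 3] \<and>
     (\<forall>j<n. Suc j + s \<le> w ! j + k)}"

lemma drop_avoidersD:
  assumes "w \<in> drop_avoiders s n k"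
  shows "set w = {s<..s + n}" "distinct w" "length w = n"
    "avoids w [2, 1, 3]" "\<And>j. j < n \<Longrightarrow> Suc j + s \<le> w ! j + k"
proof -
  show *: "set w = {s<..s + n}" "distinct w" "avoids w [2, 1, 3]"
    "\<And>j. j < n \<Longrightarrow> Suc j + s \<le> w ! j + k"
    using assms unfolding drop_avoiders_def permutations_of_set_def by blast+
  show "length w = n"
    using distinct_card[OF *(2)] by (simp add: *(1))
qed

lemma finite_drop_avoiders [simp]: "finite (drop_avoiders s n k)"
  by (simp add: drop_avoiders_def)

lemma drop_avoiders_0: "drop_avoiders s 0 k = {[]}"
  by (auto simp: drop_avoiders_def avoids_213 simp del: One_nat_def)

text \<open>Positions are at most \<open>n + 1\<close> and values at least \<open>s + 1\<close>, so
  relative to the offset no drop exceeds \<open>n\<close>.\<close>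

lemma drop_avoiders_Suc_ge: "n \<le> k \<Longrightarrow> drop_avoiders s (Suc n) k = drop_avoiders s (Suc n) n"
proof -
  assume k: "n \<le> k"
  have "Suc j + s \<le> w ! j + l" if "set w = {s<..s + Suc n}" "distinct w" "j < Suc n" "n \<le> l" for w j l
  proof -
    have "length w = Suc n"
      using that distinct_card[of w] by simp
    then have "w ! j \<in> {s<..s + Suc n}"
      using that nth_mem[of j w] by simp
    then show ?thesis
      using that by simp
  qed
  then show ?thesis
    using k by (auto simp: drop_avoiders_def permutations_of_set_def simp del: One_nat_def)
qed

text \<open>The drop bound at position \<open>j + 1\<close> is written additively over the naturals;
  for \<open>n = 0\<close> it is vacuous, in agreement with the special case in
  \<open>A_set\<close>.\<close>

lemma A_avoid_213_eq: "A_avoid n k [2, 1, 3] = drop_avoiders 0 n k"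
proof -
  have "maxdrop w \<le> int k \<longleftrightarrow> (\<forall>j<n. Suc j \<le> w ! j + k)" if "length w = n" "n \<noteq> 0" for w
  proof -
    have "maxdrop w \<le> int k \<longleftrightarrow> (\<forall>i\<in>{1..n}. int i - int (entry w i) \<le> int k)"
      using that by (simp add: maxdrop_def)
    also have "\<dots> \<longleftrightarrow> (\<forall>i\<in>Suc ` {..<n}. i \<le> entry w i + k)"
      by (simp add: image_Suc_lessThan diff_le_eq add.commute flip: of_nat_add)
    also have "\<dots> \<longleftrightarrow> (\<forall>j<n. Suc j \<le> w ! j + k)"
      by auto
    finally show ?thesis .
  qed
  moreover have "length w = n" if "w \<in> permutations_of_set {1..n}" for w
    using length_finite_permutations_of_set[OF that] by simp
  moreover have "{0<..0 + n} = {1..n}"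
    by auto
  ultimately show ?thesis
    by (auto simp: A_avoid_def A_set_def drop_avoiders_def simp del: One_nat_def)
qed

section \<open>Splitting words with bounded drops at the minimum\<close>

lemma all_less_append_Cons_iff:
  "length u = i \<Longrightarrow> i \<le> n \<Longrightarrow> (\<forall>j<Suc n. P j ((u @ c # v) ! j)) \<longleftrightarrow>
    (\<forall>j<i. P j (u ! j)) \<and> P i c \<and> (\<forall>j<n - i. P (Suc (i + j)) (v ! j))"
proof (intro iffI conjI allI impI)
  assume *: "length u = i" "i \<le> n" "\<forall>j<Suc n. P j ((u @ c # v) ! j)"
  show "P j (u ! j)" if "j < i" for j
    using *(3)[rule_format, of j] *(1,2) that by (simp add: nth_append)
  show "P i c"
    using *(3)[rule_format, of i] *(1,2) by (simp add: nth_append)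
  show "P (Suc (i + j)) (v ! j)" if "j < n - i" for j
    using *(3)[rule_format, of "Suc (i + j)"] *(1,2) that by (simp add: nth_append)
next
  fix j
  assume *: "length u = i" "i \<le> n" "j < Suc n"
    "(\<forall>j<i. P j (u ! j)) \<and> P i c \<and> (\<forall>j<n - i. P (Suc (i + j)) (v ! j))"
  consider "j < i" | "j = i" | d where "j = Suc (i + d)"
    using less_iff_Suc_add[of i j] by (metis nat_neq_iff)
  then show "P j ((u @ c # v) ! j)"
    using * by cases (auto simp: nth_append)
qed

text \<open>The \<open>i\<close> largest values go to \<open>u\<close>. At the minimum the drop is
  \<open>i \<le> k\<close>; in \<open>v\<close> positions are shifted by \<open>i + 1\<close> but
  the offset only by one, so the bound \<open>k - i\<close> there corresponds to \<open>k\<close> in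
  the whole word.\<close>

lemma append_Suc_Cons_in_drop_avoiders:
  assumes i: "i \<le> k" "k \<le> n" and u: "u \<in> drop_avoiders (Suc s + (n - i)) i i"
    and v: "v \<in> drop_avoiders (Suc s) (n - i) (k - i)"
  shows "u @ Suc s # v \<in> drop_avoiders s (Suc n) k"
proof -
  have set: "set u = {Suc s + (n - i)<..Suc s + n}" "set v = {Suc s<..Suc s + (n - i)}"
    using drop_avoidersD(1)[OF u] drop_avoidersD(1)[OF v] i by simp_all
  have "set (u @ Suc s # v) = {s<..s + Suc n}"
    using i by (auto simp: set)
  moreover have "distinct (u @ Suc s # v)"
    using drop_avoidersD(2)[OF u] drop_avoidersD(2)[OF v] by (auto simp: set)
  moreover have "avoids (u @ Suc s # v) [2, 1, 3]"
    using drop_avoidersD(4)[OF u] drop_avoidersD(4)[OF v]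
    by (subst avoids_213_append_min) (auto simp: set simp del: One_nat_def)
  moreover have "\<forall>j<Suc n. Suc j + s \<le> (u @ Suc s # v) ! j + k"
  proof (subst all_less_append_Cons_iff)
    show "length u = i"
      using u by (rule drop_avoidersD)
    have "Suc j + s \<le> u ! j + k" if "j < i" for j
      using drop_avoidersD(5)[OF u that] i by linarith
    moreover have "Suc (Suc (i + j)) + s \<le> v ! j + k" if "j < n - i" for j
      using drop_avoidersD(5)[OF v that] i by linarith
    ultimately show "(\<forall>j<i. Suc j + s \<le> u ! j + k) \<and> Suc i + s \<le> Suc s + k \<and>
        (\<forall>j<n - i. Suc (Suc (i + j)) + s \<le> v ! j + k)"
      using i by simp
  qed (use i in simp)
  ultimately show ?thesis
    by (simp add: drop_avoiders_def permutations_of_set_def del: One_nat_def)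
qed

text \<open>Cutting at the minimum \<open>s + 1\<close> inverts the preceding construction:
  avoidance puts \<open>v\<close> below \<open>u\<close>, and \<open>interval_split\<close> turns
  the lengths into value ranges.\<close>

lemma drop_avoiders_SucE:
  assumes w: "w \<in> drop_avoiders s (Suc n) k" and k: "k \<le> n"
  obtains i u v where "i \<le> k" "u \<in> drop_avoiders (Suc s + (n - i)) i i"
    "v \<in> drop_avoiders (Suc s) (n - i) (k - i)" "w = u @ Suc s # v"
proof -
  have "Suc s \<in> set w"
    using drop_avoidersD(1)[OF w] by simp
  then obtain u v where uv: "w = u @ Suc s # v"
    by (meson split_list)
  define i where "i = length u"
  have len: "length u + length v = n"
    using drop_avoidersD(3)[OF w] by (simp add: uv)
  have dist: "distinct u" "distinct v" "set u \<inter> set v = {}" "Suc s \<notin> set u \<union> set v"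
    using drop_avoidersD(2)[OF w] by (auto simp: uv)
  have "insert (Suc s) (set u \<union> set v) = {s<..s + Suc n}"
    using drop_avoidersD(1)[OF w] by (simp add: uv)
  then have "set u \<union> set v = {s<..s + Suc n} - {Suc s}"
    using dist(4) by (metis Diff_insert_absorb)
  also have "\<dots> = {Suc s<..Suc s + n}"
    by auto
  finally have un: "set u \<union> set v = {Suc s<..Suc s + n}" .
  have min: "\<forall>x\<in>set u \<union> set v. Suc s < x"
    unfolding un by simp
  have av: "avoids u [2, 1, 3]" "avoids v [2, 1, 3]" "\<forall>x\<in>set u. \<forall>y\<in>set v. y \<le> x"
    using drop_avoidersD(4)[OF w] unfolding uv avoids_213_append_min[OF min] by blast+
  have less: "y < x" if "x \<in> set u" "y \<in> set v" for x y
    using av(3) dist(3) that by (metis disjoint_iff le_neq_implies_less)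
  have split: "set v = {Suc s<..Suc s + card (set v)}" "set u = {Suc s + card (set v)<..Suc s + n}"
    by (rule interval_split[OF un]; fact less)+
  have card: "card (set v) = n - i"
    using distinct_card[OF dist(2)] len by (simp add: i_def)
  have set: "set v = {Suc s<..Suc s + (n - i)}" "set u = {Suc s + (n - i)<..Suc s + (n - i) + i}"
    using split len by (simp_all only: card) (simp add: i_def)
  have "\<forall>j<Suc n. Suc j + s \<le> (u @ Suc s # v) ! j + k"
    using drop_avoidersD(5)[OF w] by (simp add: uv)
  then have "(\<forall>j<i. Suc j + s \<le> u ! j + k) \<and> Suc i + s \<le> Suc s + k \<and>
      (\<forall>j<n - i. Suc (Suc (i + j)) + s \<le> v ! j + k)"
    using all_less_append_Cons_iff[of u i n "\<lambda>j x. Suc j + s \<le> x + k" "Suc s" v] len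
    by (simp add: i_def)
  then have drop: "i \<le> k" "\<forall>j<n - i. Suc (Suc (i + j)) + s \<le> v ! j + k"
    by simp_all
  \<comment> \<open>The bound \<open>i\<close> on \<open>u\<close> is automatic, since its values
    exceed the offset and its positions are at most \<open>i\<close>.\<close>
  have "Suc j + (Suc s + (n - i)) \<le> u ! j + i" if "j < i" for j
  proof -
    have "u ! j \<in> {Suc s + (n - i)<..Suc s + (n - i) + i}"
      using that unfolding set(2)[symmetric] by (simp add: i_def)
    then show ?thesis
      using that by simp
  qed
  then have u: "u \<in> drop_avoiders (Suc s + (n - i)) i i"
    unfolding drop_avoiders_def permutations_of_set_def using dist(1) av(1) set(2) by blast
  have "Suc j + Suc s \<le> v ! j + (k - i)" if "j < n - i" for j
    using drop(2)[rule_format, OF that] drop(1) by simp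
  then have "v \<in> drop_avoiders (Suc s) (n - i) (k - i)"
    unfolding drop_avoiders_def permutations_of_set_def using dist(2) av(2) set(1) by blast
  then show ?thesis
    using that[OF drop(1) u _ uv] by blast
qed

text \<open>Injectivity holds because \<open>s + 1\<close> occurs in neither \<open>u\<close> nor
  \<open>v\<close> and so marks the cut, and \<open>i\<close> is the length of
  \<open>u\<close>.\<close>

lemma drop_avoiders_Suc:
  assumes "k \<le> n"
  shows "bij_betw (\<lambda>(i, u, v). u @ Suc s # v)
    (SIGMA i:{..k}. drop_avoiders (Suc s + (n - i)) i i \<times> drop_avoiders (Suc s) (n - i) (k - i))
    (drop_avoiders s (Suc n) k)" (is "bij_betw ?f ?D ?R")
  unfolding bij_betw_def
proof (intro conjI equalityI subsetI)
  have inj: "i = i' \<and> u = u' \<and> v = v'"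
    if *: "u \<in> drop_avoiders (Suc s + (n - i)) i i"
      "v \<in> drop_avoiders (Suc s) (n - i) (k - i)"
      "u' \<in> drop_avoiders (Suc s + (n - i')) i' i'"
      "v' \<in> drop_avoiders (Suc s) (n - i') (k - i')" "u @ Suc s # v = u' @ Suc s # v'"
    for i u v i' u' v'
  proof -
    have "Suc s \<notin> set u" "Suc s \<notin> set v"
      using drop_avoidersD(1)[OF *(1)] drop_avoidersD(1)[OF *(2)] by auto
    then have "u = u'" "v = v'"
      using *(5) by (simp_all add: append_Cons_eq_iff)
    then show ?thesis
      using drop_avoidersD(3)[OF *(1)] drop_avoidersD(3)[OF *(3)] by simp
  qed
  show "inj_on ?f ?D"
  proof (rule inj_onI)
    fix x y assume *: "x \<in> ?D" "y \<in> ?D" "?f x = ?f y"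
    obtain i u v where "x = (i, u, v)"
      by (rule prod_cases3)
    moreover obtain i' u' v' where "y = (i', u', v')"
      by (rule prod_cases3)
    ultimately show "x = y"
      using * inj[of u i v u' i' v'] by simp
  qed
  show "w \<in> ?R" if "w \<in> ?f ` ?D" for w
  proof -
    obtain x where x: "x \<in> ?D" "w = ?f x"
      using \<open>w \<in> ?f ` ?D\<close> by blast
    obtain i u v where iuv: "x = (i, u, v)"
      by (rule prod_cases3)
    then have "i \<le> k" "u \<in> drop_avoiders (Suc s + (n - i)) i i"
      "v \<in> drop_avoiders (Suc s) (n - i) (k - i)"
      using x(1) by simp_all
    then have "u @ Suc s # v \<in> drop_avoiders s (Suc n) k"
      using assms by (intro append_Suc_Cons_in_drop_avoiders)
    then show ?thesis
      by (simp add: x(2) iuv)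
  qed
  show "w \<in> ?f ` ?D" if w: "w \<in> ?R" for w
  proof -
    obtain i u v where "i \<le> k" "u \<in> drop_avoiders (Suc s + (n - i)) i i"
      "v \<in> drop_avoiders (Suc s) (n - i) (k - i)" "w = u @ Suc s # v"
      using w assms by (rule drop_avoiders_SucE)
    then have "(i, u, v) \<in> ?D" "w = ?f (i, u, v)"
      by simp_all
    then show ?thesis
      by (rule rev_image_eqI)
  qed
qed

lemma sum_des_drop_avoiders:
  fixes p :: "'a::comm_semiring_1"
  shows "(\<Sum>w\<in>drop_avoiders s n k. p ^ des w) = ballot_poly p n k"
\<comment> \<open>Strong induction, as the factors have lengths \<open>i\<close> and
  \<open>m - i\<close>; \<open>s\<close> stays arbitrary since each factor has its own
  offset.\<close>
proof (induction n arbitrary: s k rule: less_induct)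
  case (less n)
  show ?case
  proof (cases n)
    case 0
    then show ?thesis
      by (simp add: drop_avoiders_0)
  next
    case n: (Suc m)
    let ?U = "\<lambda>s i. drop_avoiders (Suc s + (m - i)) i i"
    let ?V = "\<lambda>s k i. drop_avoiders (Suc s) (m - i) (k - i)"
    have below: "(\<Sum>w\<in>drop_avoiders s (Suc m) k. p ^ des w) = ballot_poly p (Suc m) k"
      if k: "k \<le> m" for k
    proof -
      have summand: "(\<Sum>(u, v)\<in>?U s i \<times> ?V s k i. p ^ des (u @ Suc s # v)) =
          p ^ of_bool (i \<noteq> 0) * (ballot_poly p i i * ballot_poly p (m - i) (k - i))"
        if i: "i \<le> k" for i
      proof -
        have "des (u @ Suc s # v) = des u + of_bool (i \<noteq> 0) + des v"
          if "u \<in> ?U s i" "v \<in> ?V s k i" for u v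
        proof -
          have "u \<noteq> [] \<longleftrightarrow> i \<noteq> 0"
            using drop_avoidersD(3)[OF that(1)] by auto
          moreover have "\<forall>x\<in>set u \<union> set v. Suc s < x"
            using drop_avoidersD(1)[OF that(1)] drop_avoidersD(1)[OF that(2)] by auto
          ultimately show ?thesis
            by (simp add: des_append_min)
        qed
        then have "(\<Sum>(u, v)\<in>?U s i \<times> ?V s k i. p ^ des (u @ Suc s # v)) =
            (\<Sum>(u, v)\<in>?U s i \<times> ?V s k i. p ^ of_bool (i \<noteq> 0) * (p ^ des u * p ^ des v))"
          by (intro sum.cong refl) (auto simp: power_add mult_ac)
        also have "\<dots> = p ^ of_bool (i \<noteq> 0) * ((\<Sum>u\<in>?U s i. p ^ des u) * (\<Sum>v\<in>?V s k i. p ^ des v))"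
          unfolding sum_product sum.cartesian_product
          by (simp add: sum_distrib_left case_prod_unfold)
        also have "\<dots> = p ^ of_bool (i \<noteq> 0) * (ballot_poly p i i * ballot_poly p (m - i) (k - i))"
          using i k by (simp add: less n)
        finally show ?thesis .
      qed
      have "(\<Sum>w\<in>drop_avoiders s (Suc m) k. p ^ des w) =
          (\<Sum>(i, u, v)\<in>(SIGMA i:{..k}. ?U s i \<times> ?V s k i). p ^ des (u @ Suc s # v))"
        by (subst sum.reindex_bij_betw[OF drop_avoiders_Suc[OF k], symmetric])
          (simp add: case_prod_unfold)
      also have "\<dots> = (\<Sum>i\<le>k. \<Sum>(u, v)\<in>?U s i \<times> ?V s k i. p ^ des (u @ Suc s # v))"
        by (subst sum.Sigma) (auto simp: case_prod_unfold)
      also have "\<dots> = (\<Sum>i\<le>k. p ^ of_bool (i \<noteq> 0) *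
          (ballot_poly p i i * ballot_poly p (m - i) (k - i)))"
        by (intro sum.cong refl summand) simp
      \<comment> \<open>The term \<open>i = 0\<close> has an empty \<open>u\<close> and yields
        \<open>ballot_poly p m k\<close>; the others, with \<open>i = j + 1\<close>, carry the
        factor \<open>p\<close> of the descent into the minimum.\<close>
      also have "\<dots> = ballot_poly p m k +
          p * (\<Sum>j<k. ballot_poly p (Suc j) (Suc j) * ballot_poly p (m - Suc j) (k - Suc j))"
        by (simp add: sum.atMost_shift sum_distrib_left)
      also have "\<dots> = ballot_poly p (Suc m) k"
        using k by (rule ballot_poly_convolution[symmetric])
      finally show ?thesis .
    qed
    show ?thesis
    proof (cases "k \<le> m")
      case False
      then show ?thesis
        using below[of m] by (simp add: n drop_avoiders_Suc_ge[of m k] ballot_poly_Suc_ge[of m k])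
    qed (simp add: n below)
  qed
qed

theorem theorem1p3:
  fixes n k :: nat and p :: "'a::comm_semiring_1"
  assumes "k \<le> n"
  shows "(\<Sum>w\<in>A_avoid n k [2, 1, 3]. p ^ des w) = (\<Sum>s\<in>S_last (n + 1) (k + 1) [3, 2, 1]. p ^ vnw s)
       \<and> (\<Sum>s\<in>S_last (n + 1) (k + 1) [3, 2, 1]. p ^ vnw s) = (\<Sum>a\<in>Gamma_seqs n k. p ^ vpk a)"
  using sum_vnw_S_last[OF assms, of p] sum_vpk_Gamma_seqs[OF assms, of p]
    sum_des_drop_avoiders[where s = 0 and n = n and k = k and p = p]
  unfolding A_avoid_213_eq by simp

end
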